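(* The asymmetric simple exclusion process is integrable, in the sense that its local generator on two lattice sites satisfies the (braided) Yang-Baxter equation, up to adding a constant times the identity matrix. Explicitly: let $\alpha>0$ and $\beta\ge 0$ be real numbers, let $q=\sqrt{\beta/\alpha}$, and let $$\mathcal{L}=\alpha\begin{pmatrix}0&0&0&0\\0&-1&1&0\\0&q^2&-q^2&0\\0&0&0&0\end{pmatrix},$$ regarded as a linear operator on $\mathbb{C}^2\otimes\mathbb{C}^2$. Then there exists a constant $c\in\mathbb{C}$ such that the operator $R=\mathcal{L}+c\,\mathrm{Id}_4$ satisfies $$R_{1,2}R_{2,3}R_{1,2}=R_{2,3}R_{1,2}R_{2,3}$$ as an identity of linear operators on $(\mathbb{C}^2)^{\otimes 3}$.
   Context: The asymmetric simple exclusion process (ASEP) on a one-dimensional lattice is the continuous-time Markov process in which each site holds at most one particle, each particle jumps one step left at exponential rate $\alpha$ and one step right at exponential rate $\beta$, and jumps to occupied sites are blocked; $q=\sqrt{\beta/\alpha}$ is the asymmetry parameter. A particle is represented by the basis vector $e_1=(1,0)$ of $\mathbb{C}^2$ and an empty site (hole) by $e_2=(0,1)$, so that configurations on two sites correspond to the basis $e_1\otimes e_1,\ e_1\otimes e_2,\ e_2\otimes e_1,\ e_2\otimes e_2$ (in this order) of $\mathbb{C}^2\otimes\mathbb{C}^2$. The generator of ASEP on two lattice sites (the local generator) is the $4\times 4$ matrix $\mathcal{L}$ displayed in the claim. For a linear operator $R$ on $\mathbb{C}^2\otimes\mathbb{C}^2$, the operators $R_{1,2}=R\otimes \mathrm{Id}_2$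 and $R_{2,3}=\mathrm{Id}_2\otimes R$ act on $(\mathbb{C}^2)^{\otimes 3}$, where $\mathrm{Id}_n$ denotes the $n\times n$ identity matrix. The equation $R_{1,2}R_{2,3}R_{1,2}=R_{2,3}R_{1,2}R_{2,3}$ is the braided Yang-Baxter equation, also called simply the Yang-Baxter equation. *)

theory Defs
  imports "Jordan_Normal_Form.Matrix" Complex_Main
begin

text \<open>
  The Kronecker product: the matrix of the tensor product of two linear maps with respect to
  the product bases ordered lexicographically, so the basis vector \<open>e i \<otimes> e j\<close> (counting from 0)
  of the tensor product with an \<open>n\<close>-dimensional second factor has index \<open>n * i + j\<close>.
  In particular the tensor square of the two-dimensional space has the basis order
  \<open>e 0 \<otimes> e 0\<close>, \<open>e 0 \<otimes> e 1\<close>, \<open>e 1 \<otimes> e 0\<close>, \<open>e 1 \<otimes> e 1\<close>, where \<open>e 0\<close> is a particle and \<open>e 1\<close> a hole.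
\<close>

definition kronecker :: "'a :: times mat \<Rightarrow> 'a mat \<Rightarrow> 'a mat"  (infixl "\<otimes>\<^sub>m" 70) where
  "A \<otimes>\<^sub>m B = mat (dim_row A * dim_row B) (dim_col A * dim_col B)
     (\<lambda>(i, j). A $$ (i div dim_row B, j div dim_col B) * B $$ (i mod dim_row B, j mod dim_col B))"

definition leg12 :: "complex mat \<Rightarrow> complex mat" where
  "leg12 R = R \<otimes>\<^sub>m 1\<^sub>m 2"

definition leg23 :: "complex mat \<Rightarrow> complex mat" where
  "leg23 R = 1\<^sub>m 2 \<otimes>\<^sub>m R"

definition braided_yang_baxter :: "complex mat \<Rightarrow> bool" where
  "braided_yang_baxter R \<longleftrightarrow>
     leg12 R * leg23 R * leg12 R = leg23 R * leg12 R * leg23 R"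

definition asep_asymmetry :: "real \<Rightarrow> real \<Rightarrow> real" where
  "asep_asymmetry \<alpha> \<beta> = sqrt (\<beta> / \<alpha>)"

definition asep_local_generator :: "real \<Rightarrow> real \<Rightarrow> complex mat" where
  "asep_local_generator \<alpha> \<beta> =
     (let q = complex_of_real (asep_asymmetry \<alpha> \<beta>) in
      complex_of_real \<alpha> \<cdot>\<^sub>m mat_of_rows_list 4
        [[0,  0,    0,    0],
         [0, -1,    1,    0],
         [0, q^2, - (q^2), 0],
         [0,  0,    0,    0]])"

end

theory Submission
  imports Defs
begin

text \<open>
  The constant is \<open>c = \<alpha>\<close>, and it comes from the Temperley--Lieb structure of the generator.
  Write \<open>U = - \<L>\<close> for the local generator \<open>\<L>\<close>.  The operator \<open>U\<close> has rank one, so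
  \<open>U\<^sup>2 = (\<alpha> + \<beta>) U\<close>, where \<open>\<alpha> + \<beta>\<close> is its trace, and the two legs satisfy
  \<open>U\<^sub>1 U\<^sub>2 U\<^sub>1 = \<alpha> \<beta> U\<^sub>1\<close> and \<open>U\<^sub>2 U\<^sub>1 U\<^sub>2 = \<alpha> \<beta> U\<^sub>2\<close>.
  For \<open>R = c - U\<close> the two sides of the braid relation therefore differ by
  \<open>- (c\<^sup>2 - (\<alpha> + \<beta>) c + \<alpha> \<beta>) (U\<^sub>1 - U\<^sub>2) = - (c - \<alpha>) (c - \<beta>) (U\<^sub>1 - U\<^sub>2)\<close>,
  which vanishes exactly for \<open>c = \<alpha>\<close> and \<open>c = \<beta>\<close>.

  The choice \<open>c = \<alpha>\<close> cancels one diagonal entry and leaves the sparse matrix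
  \<open>hecke_matrix \<alpha> \<beta>\<close> below, the standard braid generator of the Hecke algebra, with eigenvalues
  \<open>\<alpha>\<close> and \<open>- \<beta>\<close>.  Its legs have so few nonzero entries that the braid relation
  (\<open>braided_yang_baxter_hecke_matrix\<close>) is a short polynomial identity in each entry of an
  8 by 8 matrix.  The only use of the square root is \<open>\<alpha> q\<^sup>2 = \<beta>\<close>
  (\<open>asep_shift_eq_hecke_matrix\<close>).
\<close>

definition hecke_matrix :: "complex \<Rightarrow> complex \<Rightarrow> complex mat" where
  "hecke_matrix a b = mat_of_rows_list 4
     [[a, 0, 0,     0],
      [0, 0, a,     0],
      [0, b, a - b, 0],
      [0, 0, 0,     a]]"

lemma all_less_4: "(\<forall>i<4. P i) \<longleftrightarrow> P 0 \<and> P 1 \<and> P 2 \<and> P (3::nat)"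
  by (simp add: numeral_eq_Suc All_less_Suc conj_ac)

lemma all_less_8:
  "(\<forall>i<8. P i) \<longleftrightarrow> P 0 \<and> P 1 \<and> P 2 \<and> P 3 \<and> P 4 \<and> P 5 \<and> P 6 \<and> P (7::nat)"
  by (simp add: numeral_eq_Suc All_less_Suc conj_ac)

lemma leg12_hecke_matrix:
  "leg12 (hecke_matrix a b) = mat_of_rows_list 8
     [[a, 0, 0, 0, 0,     0,     0, 0],
      [0, a, 0, 0, 0,     0,     0, 0],
      [0, 0, 0, 0, a,     0,     0, 0],
      [0, 0, 0, 0, 0,     a,     0, 0],
      [0, 0, b, 0, a - b, 0,     0, 0],
      [0, 0, 0, b, 0,     a - b, 0, 0],
      [0, 0, 0, 0, 0,     0,     a, 0],
      [0, 0, 0, 0, 0,     0,     0, a]]"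
  (* The row bound is the length of a list, hence an iterated successor: All_less_Suc unfolds it,
     while all_less_8 unfolds the column bound, a numeral. *)
  by (simp add: leg12_def kronecker_def hecke_matrix_def mat_of_rows_list_def
      mat_eq_iff all_less_8 All_less_Suc)

lemma leg23_hecke_matrix:
  "leg23 (hecke_matrix a b) = mat_of_rows_list 8
     [[a, 0, 0,     0, 0, 0, 0,     0],
      [0, 0, a,     0, 0, 0, 0,     0],
      [0, b, a - b, 0, 0, 0, 0,     0],
      [0, 0, 0,     a, 0, 0, 0,     0],
      [0, 0, 0,     0, a, 0, 0,     0],
      [0, 0, 0,     0, 0, 0, a,     0],
      [0, 0, 0,     0, 0, b, a - b, 0],
      [0, 0, 0,     0, 0, 0, 0,     a]]"
  by (simp add: leg23_def kronecker_def hecke_matrix_def mat_of_rows_list_def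
      mat_eq_iff all_less_8 All_less_Suc)

text \<open>
  Multiplying on lists of rows lets the simplifier evaluate a product of explicit matrices in one
  pass, instead of treating every pair of indices as a separate goal.
\<close>

lemma mat_of_rows_list_mult:
  fixes rs ss :: "'a :: semiring_0 list list"
  assumes "length ss = n" and "\<forall>r \<in> set rs. length r = n"
  shows "mat_of_rows_list n rs * mat_of_rows_list m ss =
    mat_of_rows_list m
      (map (\<lambda>r. map (\<lambda>j. sum_list (map2 (\<lambda>x s. x * s ! j) r ss)) [0..<m]) rs)"
proof (rule eq_matI, goal_cases)
  case (1 i j)
  then show ?case
    using assms by (simp add: mat_of_rows_list_def scalar_prod_def sum_list_sum_nth)
qed (simp_all add: mat_of_rows_list_def)

lemma upt_0_8: "[0..<8] = [0, 1, 2, 3, 4, 5, 6, 7]"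
  by (simp add: eval_nat_numeral)

lemma braided_yang_baxter_hecke_matrix: "braided_yang_baxter (hecke_matrix a b)"
  unfolding braided_yang_baxter_def leg12_hecke_matrix leg23_hecke_matrix
  by (simp add: mat_of_rows_list_mult upt_0_8 algebra_simps)

lemma asep_shift_eq_hecke_matrix:
  assumes "\<alpha> > 0" and "\<beta> \<ge> 0"
  shows "asep_local_generator \<alpha> \<beta> + complex_of_real \<alpha> \<cdot>\<^sub>m 1\<^sub>m 4 = hecke_matrix \<alpha> \<beta>"
proof -
  have "\<alpha> * (asep_asymmetry \<alpha> \<beta>)\<^sup>2 = \<beta>"
    using assms by (simp add: asep_asymmetry_def)
  then have q: "complex_of_real \<alpha> * (complex_of_real (asep_asymmetry \<alpha> \<beta>))\<^sup>2 = complex_of_real \<beta>"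
    by (metis of_real_mult of_real_power)
  show ?thesis
    by (simp add: mat_eq_iff all_less_4 asep_local_generator_def hecke_matrix_def
        mat_of_rows_list_def Let_def q)
qed

theorem mainTheorem1:
  fixes \<alpha> \<beta> :: real
  assumes "\<alpha> > 0" and "\<beta> \<ge> 0"
  shows "\<exists>c :: complex. braided_yang_baxter (asep_local_generator \<alpha> \<beta> + c \<cdot>\<^sub>m 1\<^sub>m 4)"
  using asep_shift_eq_hecke_matrix[OF assms] braided_yang_baxter_hecke_matrix by metis

end
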